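(* Let $\mathbb{F}$ be a field with $\mathrm{char}(\mathbb{F})\neq2$ and let $\alpha\in\mathbb{F}\setminus\{0,1,\frac12\}$. Let $E$ be a $2$-dimensional vector space over $\mathbb{F}$ with a symmetric bilinear form $b$, spanned by vectors $e,f$ with $b(e,e)=b(f,f)=1$, and put $\mu:=b(e,f)$. In the split spin factor $S(b,\alpha)$ let $x=\frac12(e+\alpha z_1+(\alpha+1)z_2)$ and $y=\frac12(f+\alpha z_1+(\alpha+1)z_2)$. If $\alpha\neq-1$ and $\mu\neq1$, then $S(b,\alpha)$ is generated as an algebra by $x$ and $y$, and $S(b,\alpha)$ is isomorphic to Yabe's algebra $\mathrm{III}(\alpha,\frac12,\delta)$ with $\delta=-2\mu-1$.
   Context: The split spin factor $S(b,\alpha)$ is the commutative (not necessarily associative) algebra on the vector space $E\oplus\mathbb{F}z_1\oplus\mathbb{F}z_2$ with multiplication $z_1^2=z_1$, $z_2^2=z_2$, $z_1z_2=0$, $ez_1=\alpha e$, $ez_2=(1-\alpha)e$, $ef=-b(e,f)z$ for all $e,f\in E$, where $z:=\alpha(\alpha-2)z_1+(\alpha-1)(\alpha+1)z_2$. Yabe's algebra $\mathrm{III}(\alpha,\frac12,\delta)$, for $\delta\in\mathbb{F}$, is the $4$-dimensional commutative algebra over $\mathbb{F}$ with basis $a_{-1},a_0,a_1,q$ and multiplication, writing $s:=\frac{2\alpha-1}{4}\left(a_1+a_{-1}+(\delta+1)a_0\right)+q$: $a_i^2=a_i$ for $i\in\{-1,0,1\}$; $a_0a_1=\frac12(a_0+a_1)+s$;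 $a_0a_{-1}=\frac12(a_0+a_{-1})+s$; $a_1a_{-1}=\frac12(a_1+a_{-1})+(1-\delta)s$; $q\,a_i=-\frac{\alpha(\alpha+1)(\delta+3)}{8}\,a_i$ for $i\in\{-1,0,1\}$; $q^2=-\frac{\alpha(\alpha+1)(\delta+3)}{8}\,q$. *)

theory Defs
  imports "HOL-Analysis.Cartesian_Space" "HOL-Analysis.Product_Vector"
begin

section \<open>Nonassociative algebras\<close>

text \<open>A commutative, not necessarily associative or unital algebra over a field is given by a
  scalar multiplication and a product on a whole type.\<close>

locale comm_nonassoc_algebra = vector_space smul
  for smul :: "'a::field \<Rightarrow> 'v::ab_group_add \<Rightarrow> 'v" +
  fixes mult :: "'v \<Rightarrow> 'v \<Rightarrow> 'v"
  assumes mult_linear: "Vector_Spaces.linear smul smul (mult u)"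
    and mult_commute: "mult u v = mult v u"

definition subalgebra :: "('a::field \<Rightarrow> 'v::ab_group_add \<Rightarrow> 'v) \<Rightarrow> ('v \<Rightarrow> 'v \<Rightarrow> 'v) \<Rightarrow> 'v set \<Rightarrow> bool"
  where "subalgebra smul mult U \<longleftrightarrow>
    module.subspace smul U \<and> (\<forall>u\<in>U. \<forall>v\<in>U. mult u v \<in> U)"

definition generates_algebra ::
    "('a::field \<Rightarrow> 'v::ab_group_add \<Rightarrow> 'v) \<Rightarrow> ('v \<Rightarrow> 'v \<Rightarrow> 'v) \<Rightarrow> 'v set \<Rightarrow> bool"
  where "generates_algebra smul mult X \<longleftrightarrow> subalgebra smul mult hull X = UNIV"

definition algebra_isomorphic ::
    "('a::field \<Rightarrow> 'v::ab_group_add \<Rightarrow> 'v) \<Rightarrow> ('v \<Rightarrow> 'v \<Rightarrow> 'v) \<Rightarrow>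
     ('a \<Rightarrow> 'w::ab_group_add \<Rightarrow> 'w) \<Rightarrow> ('w \<Rightarrow> 'w \<Rightarrow> 'w) \<Rightarrow> bool"
  where "algebra_isomorphic smul\<^sub>1 mult\<^sub>1 smul\<^sub>2 mult\<^sub>2 \<longleftrightarrow>
    (\<exists>\<phi>. Vector_Spaces.linear smul\<^sub>1 smul\<^sub>2 \<phi> \<and> bij \<phi> \<and>
         (\<forall>u v. \<phi> (mult\<^sub>1 u v) = mult\<^sub>2 (\<phi> u) (\<phi> v)))"

definition symmetric_bilinear_form ::
    "('a::field \<Rightarrow> 'e::ab_group_add \<Rightarrow> 'e) \<Rightarrow> ('e \<Rightarrow> 'e \<Rightarrow> 'a) \<Rightarrow> bool"
  where "symmetric_bilinear_form smul b \<longleftrightarrow>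
    (\<forall>u. Vector_Spaces.linear smul (*) (b u)) \<and>
    (\<forall>v. Vector_Spaces.linear smul (*) (\<lambda>u. b u v)) \<and>
    (\<forall>u v. b u v = b v u)"


section \<open>The split spin factor\<close>

text \<open>The triple \<open>(u, r, t)\<close> stands for \<open>u + r z\<^sub>1 + t z\<^sub>2\<close>. The product is the commutative
  bilinear extension of the defining relations, which are recovered below.\<close>

type_synonym ('a, 'e) ssf = "'e \<times> 'a \<times> 'a"

definition ssf_scale :: "('a::field \<Rightarrow> 'e::ab_group_add \<Rightarrow> 'e) \<Rightarrow> 'a \<Rightarrow> ('a, 'e) ssf \<Rightarrow> ('a, 'e) ssf"
  where "ssf_scale smul = module_prod.scale smul (module_prod.scale (*) (*))"

definition ssf_emb :: "'e \<Rightarrow> ('a::field, 'e) ssf"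
  where "ssf_emb u = (u, 0, 0)"

definition ssf_z1 :: "('a::field, 'e::ab_group_add) ssf"
  where "ssf_z1 = (0, 1, 0)"

definition ssf_z2 :: "('a::field, 'e::ab_group_add) ssf"
  where "ssf_z2 = (0, 0, 1)"

definition ssf_z :: "('a::field \<Rightarrow> 'e::ab_group_add \<Rightarrow> 'e) \<Rightarrow> 'a \<Rightarrow> ('a, 'e) ssf"
  where "ssf_z smul \<alpha> =
    ssf_scale smul (\<alpha> * (\<alpha> - 2)) ssf_z1 + ssf_scale smul ((\<alpha> - 1) * (\<alpha> + 1)) ssf_z2"

fun ssf_mult ::
    "('a::field \<Rightarrow> 'e::ab_group_add \<Rightarrow> 'e) \<Rightarrow> ('e \<Rightarrow> 'e \<Rightarrow> 'a) \<Rightarrow> 'a \<Rightarrow>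
     ('a, 'e) ssf \<Rightarrow> ('a, 'e) ssf \<Rightarrow> ('a, 'e) ssf"
  where "ssf_mult smul b \<alpha> (u, r, t) (u', r', t') =
    ssf_emb (smul (\<alpha> * r' + (1 - \<alpha>) * t') u + smul (\<alpha> * r + (1 - \<alpha>) * t) u')
    + ssf_scale smul (r * r') ssf_z1 + ssf_scale smul (t * t') ssf_z2
    + ssf_scale smul (- b u u') (ssf_z smul \<alpha>)"

context
  fixes smul :: "'a::field \<Rightarrow> 'e::ab_group_add \<Rightarrow> 'e" and b :: "'e \<Rightarrow> 'e \<Rightarrow> 'a"
  assumes vs: "vector_space smul" and sbf: "symmetric_bilinear_form smul b"
begin

interpretation E: vector_space smul by (fact vs)
interpretation F: vector_space "(*) :: 'a \<Rightarrow> 'a \<Rightarrow> 'a"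
  by unfold_locales (auto simp: algebra_simps)
interpretation FF: vector_space_prod "(*) :: 'a \<Rightarrow> 'a \<Rightarrow> 'a" "(*) :: 'a \<Rightarrow> 'a \<Rightarrow> 'a" ..
interpretation S: vector_space_prod smul "module_prod.scale ((*) :: 'a \<Rightarrow> 'a \<Rightarrow> 'a) (*)" ..

lemma ssf_scale_triple: "ssf_scale smul c (u, r, t) = (smul c u, c * r, c * t)"
  by (simp add: ssf_scale_def S.scale_def FF.scale_def)

lemma b_linear:
  "b (u + u') v = b u v + b u' v" "b v (u + u') = b v u + b v u'"
  "b (smul c u) v = c * b u v" "b v (smul c u) = c * b v u"
  "b 0 v = 0" "b v 0 = 0" "b u v = b v u"
proof -
  have l: "Vector_Spaces.linear smul (*) (b w)" and r: "Vector_Spaces.linear smul (*) (\<lambda>u. b u w)"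
    for w using sbf by (auto simp: symmetric_bilinear_form_def)
  interpret l: Vector_Spaces.linear smul "(*)" "b v" by (fact l)
  interpret r: Vector_Spaces.linear smul "(*)" "\<lambda>u. b u v" by (fact r)
  show "b (u + u') v = b u v + b u' v" "b v (u + u') = b v u + b v u'"
    "b (smul c u) v = c * b u v" "b v (smul c u) = c * b v u" "b 0 v = 0" "b v 0 = 0"
    by (rule r.add l.add r.scale l.scale r.zero l.zero)+
  show "b u v = b v u" using sbf by (auto simp: symmetric_bilinear_form_def)
qed

lemmas ssf_simps = ssf_scale_triple ssf_emb_def ssf_z1_def ssf_z2_def ssf_z_def

lemma ssf_comm_nonassoc_algebra:
  "comm_nonassoc_algebra (ssf_scale smul) (ssf_mult smul b \<alpha>)"
proof -
  interpret A: vector_space "ssf_scale smul"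
    unfolding ssf_scale_def by (rule S.p.vector_space_axioms)
  show ?thesis
  proof
    fix u v w :: "('a, 'e) ssf" and c :: 'a
    show "ssf_mult smul b \<alpha> u (v + w) = ssf_mult smul b \<alpha> u v + ssf_mult smul b \<alpha> u w"
      by (cases u; cases v; cases w)
        (simp add: ssf_simps b_linear E.scale_right_distrib E.scale_left_distrib algebra_simps)
    show "ssf_mult smul b \<alpha> u (ssf_scale smul c v) = ssf_scale smul c (ssf_mult smul b \<alpha> u v)"
      by (cases u; cases v)
        (simp add: ssf_simps b_linear(1-6) E.scale_right_distrib E.scale_left_distrib algebra_simps)
    show "ssf_mult smul b \<alpha> u v = ssf_mult smul b \<alpha> v u"
      by (cases u; cases v) (simp add: ssf_simps b_linear(7) algebra_simps)
  qed
qed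

lemma ssf_mult_table:
  "ssf_mult smul b \<alpha> ssf_z1 ssf_z1 = ssf_z1"
  "ssf_mult smul b \<alpha> ssf_z2 ssf_z2 = ssf_z2"
  "ssf_mult smul b \<alpha> ssf_z1 ssf_z2 = 0"
  "ssf_mult smul b \<alpha> (ssf_emb u) ssf_z1 = ssf_scale smul \<alpha> (ssf_emb u)"
  "ssf_mult smul b \<alpha> (ssf_emb u) ssf_z2 = ssf_scale smul (1 - \<alpha>) (ssf_emb u)"
  "ssf_mult smul b \<alpha> (ssf_emb u) (ssf_emb v) = ssf_scale smul (- b u v) (ssf_z smul \<alpha>)"
  by (simp_all add: ssf_simps b_linear(5,6) zero_prod_def)

end


section \<open>Yabe's algebra III with second parameter one half\<close>

text \<open>The index \<open>Am\<close> belongs to the basis vector \<open>a\<^sub>-\<^sub>1\<close>.\<close>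

datatype yabe_index = Am | A0 | A1 | Q

instance yabe_index :: finite
proof
  have "(UNIV :: yabe_index set) = {Am, A0, A1, Q}"
    using yabe_index.exhaust by auto
  then show "finite (UNIV :: yabe_index set)"
    by (metis finite.emptyI finite_insert)
qed

abbreviation yabe_basis :: "yabe_index \<Rightarrow> 'a::field ^ yabe_index"
  where "yabe_basis i \<equiv> axis i 1"

definition yabe_s :: "'a::field \<Rightarrow> 'a \<Rightarrow> 'a ^ yabe_index"
  where "yabe_s \<alpha> \<delta> =
    ((2 * \<alpha> - 1) / 4) *s (yabe_basis A1 + yabe_basis Am + (\<delta> + 1) *s yabe_basis A0) + yabe_basis Q"

fun yabe_table :: "'a::field \<Rightarrow> 'a \<Rightarrow> yabe_index \<Rightarrow> yabe_index \<Rightarrow> 'a ^ yabe_index"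
  where
    "yabe_table \<alpha> \<delta> Am Am = yabe_basis Am"
  | "yabe_table \<alpha> \<delta> A0 A0 = yabe_basis A0"
  | "yabe_table \<alpha> \<delta> A1 A1 = yabe_basis A1"
  | "yabe_table \<alpha> \<delta> A0 A1 = (1 / 2) *s (yabe_basis A0 + yabe_basis A1) + yabe_s \<alpha> \<delta>"
  | "yabe_table \<alpha> \<delta> A0 Am = (1 / 2) *s (yabe_basis A0 + yabe_basis Am) + yabe_s \<alpha> \<delta>"
  | "yabe_table \<alpha> \<delta> A1 Am =
      (1 / 2) *s (yabe_basis A1 + yabe_basis Am) + (1 - \<delta>) *s yabe_s \<alpha> \<delta>"
  | "yabe_table \<alpha> \<delta> A1 A0 = (1 / 2) *s (yabe_basis A0 + yabe_basis A1) + yabe_s \<alpha> \<delta>"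
  | "yabe_table \<alpha> \<delta> Am A0 = (1 / 2) *s (yabe_basis A0 + yabe_basis Am) + yabe_s \<alpha> \<delta>"
  | "yabe_table \<alpha> \<delta> Am A1 =
      (1 / 2) *s (yabe_basis A1 + yabe_basis Am) + (1 - \<delta>) *s yabe_s \<alpha> \<delta>"
  | "yabe_table \<alpha> \<delta> Q i = (- (\<alpha> * (\<alpha> + 1) * (\<delta> + 3) / 8)) *s yabe_basis i"
  | "yabe_table \<alpha> \<delta> i Q = (- (\<alpha> * (\<alpha> + 1) * (\<delta> + 3) / 8)) *s yabe_basis i"

definition yabe_mult ::
    "'a::field \<Rightarrow> 'a \<Rightarrow> 'a ^ yabe_index \<Rightarrow> 'a ^ yabe_index \<Rightarrow> 'a ^ yabe_index"
  where "yabe_mult \<alpha> \<delta> v w = (\<Sum>i\<in>UNIV. \<Sum>j\<in>UNIV. (v $ i * w $ j) *s yabe_table \<alpha> \<delta> i j)"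

lemma yabe_table_commute: "yabe_table \<alpha> \<delta> i j = yabe_table \<alpha> \<delta> j i"
  by (cases i; cases j) simp_all

lemma yabe_comm_nonassoc_algebra: "comm_nonassoc_algebra (*s) (yabe_mult \<alpha> \<delta>)"
proof
  fix u v w :: "'a ^ yabe_index" and c :: 'a
  show "yabe_mult \<alpha> \<delta> u (v + w) = yabe_mult \<alpha> \<delta> u v + yabe_mult \<alpha> \<delta> u w"
    by (simp add: yabe_mult_def vec.scale_left_distrib distrib_left sum.distrib)
  show "yabe_mult \<alpha> \<delta> u (c *s v) = c *s yabe_mult \<alpha> \<delta> u v"
    by (simp add: yabe_mult_def vec.scale_sum_right mult.left_commute)
  show "yabe_mult \<alpha> \<delta> u v = yabe_mult \<alpha> \<delta> v u"
    unfolding yabe_mult_def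
    by (subst sum.swap) (simp add: yabe_table_commute[of \<alpha> \<delta>] mult.commute)
qed

lemma yabe_mult_basis: "yabe_mult \<alpha> \<delta> (yabe_basis i) (yabe_basis j) = yabe_table \<alpha> \<delta> i j"
proof -
  have "(axis i 1 $ k * axis j 1 $ l) *s yabe_table \<alpha> \<delta> k l =
      (if l = j then if k = i then yabe_table \<alpha> \<delta> k l else 0 else 0)" for k l
    by (simp add: axis_def)
  then show ?thesis
    by (simp add: yabe_mult_def)
qed

end

theory Submission
  imports Defs
begin

text \<open>Write \<open>a u = (u + \<alpha> z\<^sub>1 + (\<alpha> + 1) z\<^sub>2) / 2\<close> for a vector \<open>u\<close> of \<open>E\<close>, so that \<open>x = a e\<close>
  and \<open>y = a f\<close>. Everything rests on the identity
  \<open>a u \<cdot> a v = (a u + a v) / 2 + (1 - b u v) / 4 \<cdot> z\<close> (\<open>axis_of_mult\<close>). It shows that \<open>a u\<close>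
  is idempotent when \<open>b u u = 1\<close>, and it has the shape of the products \<open>a\<^sub>i a\<^sub>j\<close> of Yabe's algebra,
  with a multiple of \<open>z\<close> in the role of \<open>s\<close>.

  Generation (\<open>subalgebra_eq_UNIV\<close>): as \<open>\<mu> \<noteq> 1\<close>, the identity puts \<open>z\<close> into every subalgebra that
  contains \<open>x\<close> and \<open>y\<close>. A combination of \<open>x z\<close> and \<open>x\<close> without component in \<open>E\<close> is
  \<open>\<alpha> (2 \<alpha> - 1) / 2\<close> times \<open>w = (\<alpha> - 1) z\<^sub>1 + (\<alpha> + 1) z\<^sub>2\<close>, and \<open>z\<close> and \<open>w\<close> span
  \<open>z\<^sub>1\<close> and \<open>z\<^sub>2\<close> since their determinant is \<open>\<alpha> + 1\<close>. Then \<open>e\<close> and \<open>f\<close> are obtained from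
  \<open>x\<close> and \<open>y\<close>.

  Isomorphism: the reflection of \<open>E\<close> that fixes \<open>e\<close> sends \<open>f\<close> to \<open>2 \<mu> e - f\<close>. Map
  \<open>a\<^sub>0, a\<^sub>1, a\<^sub>-\<^sub>1\<close> to \<open>a e, a f, a (2 \<mu> e - f)\<close>. The formula for \<open>a\<^sub>0 a\<^sub>1\<close> then forces
  \<open>s\<close> to go to \<open>(1 - \<mu>) / 4 \<cdot> z\<close>, and hence \<open>q\<close> to \<open>\<kappa> (z\<^sub>1 + z\<^sub>2)\<close> with
  \<open>\<kappa> = - \<alpha> (\<alpha> + 1) (\<delta> + 3) / 8\<close>. Since \<open>z\<^sub>1 + z\<^sub>2\<close> is the identity of the split spin factor,
  this agrees with the products of \<open>q\<close>; the remaining products are instances of \<open>axis_of_mult\<close>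
  (\<open>yabe_map_table\<close>). The linear extension is injective because \<open>e\<close> and \<open>f\<close> are linearly
  independent and \<open>\<kappa> \<noteq> 0\<close>, and it is surjective because its range is a subalgebra that contains
  the generators \<open>x\<close> and \<open>y\<close>.\<close>

section \<open>Linear algebra and algebra isomorphisms\<close>

lemma (in vector_space) scale_pair_eq_zero_imp:
  assumes "span {u, v} = UNIV" and "dim UNIV = 2" and "scale p u + scale q v = 0"
  shows "p = 0"
proof (rule ccontr)
  assume "p \<noteq> 0"
  have "scale p u = scale (- q) v"
    using assms(3) by (simp add: eq_neg_iff_add_eq_0)
  then have "scale (1 / p) (scale p u) = scale (1 / p) (scale (- q) v)"
    by (rule arg_cong)
  with \<open>p \<noteq> 0\<close> have "u = scale (- q / p) v"
    by simp
  then have "{u, v} \<subseteq> span {v}"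
    by (metis empty_subsetI insert_subset singletonI span_base span_scale)
  then have "UNIV \<subseteq> span {v}"
    using span_minimal[OF _ subspace_span] assms(1) by metis
  then have "dim UNIV \<le> card {v}"
    by (rule dim_le_card) simp
  then show False
    using assms(2) by simp
qed

lemma (in comm_nonassoc_algebra) mult_sum_scale:
  "mult (\<Sum>i\<in>I. smul (c i) (g i)) (\<Sum>j\<in>J. smul (d j) (h j)) =
    (\<Sum>i\<in>I. \<Sum>j\<in>J. smul (c i * d j) (mult (g i) (h j)))"
proof -
  have right: "mult u (\<Sum>j\<in>K. smul (k j) (w j)) = (\<Sum>j\<in>K. smul (k j) (mult u (w j)))"
    for u K and k :: "'k \<Rightarrow> 'a" and w
  proof -
    interpret m: Vector_Spaces.linear smul smul "mult u"
      by (rule mult_linear)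
    show ?thesis
      by (simp add: m.sum m.scale)
  qed
  have "mult (\<Sum>i\<in>I. smul (c i) (g i)) (\<Sum>j\<in>J. smul (d j) (h j)) =
      (\<Sum>j\<in>J. smul (d j) (mult (h j) (\<Sum>i\<in>I. smul (c i) (g i))))"
    by (simp only: right mult_commute)
  also have "\<dots> = (\<Sum>j\<in>J. \<Sum>i\<in>I. smul (c i * d j) (mult (g i) (h j)))"
    by (simp add: right scale_sum_right mult_commute mult.commute)
  finally show ?thesis
    by (simp add: sum.swap[of _ J])
qed

lemma algebra_isomorphic_sym:
  assumes "algebra_isomorphic s1 m1 s2 m2"
  shows "algebra_isomorphic s2 m2 s1 m1"
proof -
  obtain \<phi> where lin: "Vector_Spaces.linear s1 s2 \<phi>" and "bij \<phi>"
    and mult: "\<And>u v. \<phi> (m1 u v) = m2 (\<phi> u) (\<phi> v)"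
    using assms unfolding algebra_isomorphic_def by blast
  interpret \<phi>: Vector_Spaces.linear s1 s2 \<phi>
    by (rule lin)
  have inv: "inv \<phi> (\<phi> u) = u" "\<phi> (inv \<phi> w) = w" for u w
    using \<open>bij \<phi>\<close> by (simp_all add: bij_is_inj bij_is_surj surj_f_inv_f)
  have "Vector_Spaces.linear s2 s1 (inv \<phi>)"
  proof
    show "inv \<phi> (u + w) = inv \<phi> u + inv \<phi> w" for u w
      by (metis inv \<phi>.add)
    show "inv \<phi> (s2 c w) = s1 c (inv \<phi> w)" for c w
      by (metis inv \<phi>.scale)
  qed
  moreover have "inv \<phi> (m2 u w) = m1 (inv \<phi> u) (inv \<phi> w)" for u w
    by (metis inv mult)
  ultimately show ?thesis
    unfolding algebra_isomorphic_def using bij_imp_bij_inv[OF \<open>bij \<phi>\<close>] by blast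
qed

lemma sum_yabe_index: "(\<Sum>i\<in>UNIV. h i) = h Am + h A0 + h A1 + h Q"
proof -
  have UNIV: "(UNIV :: yabe_index set) = {Am, A0, A1, Q}"
    using yabe_index.exhaust by auto
  show ?thesis
    unfolding UNIV by (simp add: add.assoc)
qed

section \<open>Idempotents of the split spin factor\<close>

locale split_spin_factor =
  fixes smul :: "'a::field \<Rightarrow> 'e::ab_group_add \<Rightarrow> 'e" and b :: "'e \<Rightarrow> 'e \<Rightarrow> 'a" and \<alpha> :: 'a
  assumes vs: "vector_space smul" and sbf: "symmetric_bilinear_form smul b"
    and two_neq_0: "(2::'a) \<noteq> 0"
begin

sublocale E: vector_space smul
  by (rule vs)

sublocale S: comm_nonassoc_algebra "ssf_scale smul" "ssf_mult smul b \<alpha>"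
  by (rule ssf_comm_nonassoc_algebra[OF vs sbf])

abbreviation scale :: "'a \<Rightarrow> ('a, 'e) ssf \<Rightarrow> ('a, 'e) ssf"  (infixr "\<odot>" 75)
  where "scale \<equiv> ssf_scale smul"

abbreviation product :: "('a, 'e) ssf \<Rightarrow> ('a, 'e) ssf \<Rightarrow> ('a, 'e) ssf"  (infixl "\<star>" 70)
  where "product \<equiv> ssf_mult smul b \<alpha>"

abbreviation z :: "('a, 'e) ssf"
  where "z \<equiv> ssf_z smul \<alpha>"

lemmas ssf_coords = ssf_simps[OF vs sbf]

lemmas form_simps = b_linear(1-6)[OF vs sbf]

lemma form_commute: "b u v = b v u"
  by (rule b_linear(7)[OF vs sbf])

lemma four_neq_0: "(4::'a) \<noteq> 0"
  using two_neq_0 mult_eq_0_iff[of "2::'a" 2] by simp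

lemma eight_neq_0: "(8::'a) \<noteq> 0"
  using two_neq_0 four_neq_0 mult_eq_0_iff[of "2::'a" 4] by simp

lemmas numerals_neq_0 = two_neq_0 four_neq_0 eight_neq_0

text \<open>The family of elements \<open>(u + \<alpha> z\<^sub>1 + (\<alpha> + 1) z\<^sub>2) / 2\<close>, defined for every vector \<open>u\<close>; it is
  an idempotent when \<open>b u u = 1\<close>.\<close>

definition axis_of :: "'e \<Rightarrow> ('a, 'e) ssf"
  where "axis_of u =
    (1 / 2) \<odot> (ssf_emb u + \<alpha> \<odot> ssf_z1 + (\<alpha> + 1) \<odot> ssf_z2)"

lemma axis_of_coords: "axis_of u = (smul (1 / 2) u, \<alpha> / 2, (\<alpha> + 1) / 2)"
  by (simp add: axis_of_def ssf_coords)

text \<open>With \<open>c = \<alpha> z\<^sub>1 + (\<alpha> + 1) z\<^sub>2\<close>, the element \<open>c\<close> acts as the identity on \<open>E\<close>, because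
  \<open>\<alpha> \<alpha> + (1 - \<alpha>) (\<alpha> + 1) = 1\<close>, and \<open>c c = 2 c + z\<close>. The product of \<open>(u + c) / 2\<close> and
  \<open>(v + c) / 2\<close> is therefore a quarter of \<open>u + v + 2 c + z - b u v z\<close>.\<close>

lemma axis_of_mult:
  "axis_of u \<star> axis_of v =
    (1 / 2) \<odot> (axis_of u + axis_of v) + ((1 - b u v) / 4) \<odot> z"
proof -
  have coeff: "(\<alpha> * (\<alpha> / 2) + (1 - \<alpha>) * ((\<alpha> + 1) / 2)) * (1 / 2) = 1 / 4"
    using numerals_neq_0 by (simp add: field_simps)
  show ?thesis
    using numerals_neq_0
    by (simp add: axis_of_coords ssf_coords form_simps coeff E.scale_right_distrib)
       (simp add: field_simps)
qed

lemma axis_of_idempotent: "b u u = 1 \<Longrightarrow> axis_of u \<star> axis_of u = axis_of u"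
  unfolding axis_of_mult using two_neq_0 four_neq_0
  by (simp add: axis_of_coords ssf_coords zero_prod_def flip: E.scale_left_distrib E.scale_scale)

text \<open>The element \<open>z\<^sub>1 + z\<^sub>2\<close> is the identity of the algebra.\<close>

lemma one_mult: "(c \<odot> (ssf_z1 + ssf_z2)) \<star> v = c \<odot> v"
  by (cases v) (simp add: ssf_coords form_simps algebra_simps zero_prod_def)

end

section \<open>Generation by two idempotents\<close>

text \<open>The form may be degenerate on \<open>E\<close>: only \<open>b e f = 1\<close> is excluded, and \<open>b e f = - 1\<close> is not.
  Linear independence of \<open>e\<close> and \<open>f\<close> therefore comes from the dimension of \<open>E\<close> and not from
  the Gram matrix.\<close>

locale spanned_split_spin_factor = split_spin_factor smul b \<alpha>
  for smul :: "'a::field \<Rightarrow> 'e::ab_group_add \<Rightarrow> 'e" and b :: "'e \<Rightarrow> 'e \<Rightarrow> 'a" and \<alpha> :: 'a +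
  fixes e f :: 'e
  assumes dim_2: "vector_space.dim smul (UNIV :: 'e set) = 2"
    and span_UNIV: "module.span smul {e, f} = UNIV"
    and form_e: "b e e = 1" and form_f: "b f f = 1"
    and form_ef: "b e f \<noteq> 1"
    and \<alpha>_neq: "\<alpha> \<noteq> 0" "\<alpha> \<noteq> 1 / 2" "\<alpha> \<noteq> - 1"
begin

abbreviation \<mu> :: 'a
  where "\<mu> \<equiv> b e f"

lemma subalgebra_eq_UNIV:
  assumes sub: "subalgebra scale product U" and e: "axis_of e \<in> U" and f: "axis_of f \<in> U"
  shows "U = UNIV"
proof -
  have subspace: "S.subspace U" and closed: "\<And>u v. u \<in> U \<Longrightarrow> v \<in> U \<Longrightarrow> u \<star> v \<in> U"
    using sub by (auto simp: subalgebra_def)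
  note closure = S.subspace_add[OF subspace] S.subspace_diff[OF subspace]
    S.subspace_scale[OF subspace] closed
  have "((1 - \<mu>) / 4) \<odot> z = axis_of e \<star> axis_of f - (1 / 2) \<odot> (axis_of e + axis_of f)"
    by (simp add: axis_of_mult)
  also have "\<dots> \<in> U"
    by (intro closure e f)
  finally have "(1 / ((1 - \<mu>) / 4)) \<odot> (((1 - \<mu>) / 4) \<odot> z) \<in> U"
    by (rule closure)
  moreover have "(1 - \<mu>) / 4 \<noteq> 0"
    using form_ef four_neq_0 by simp
  ultimately have z: "z \<in> U"
    by (metis S.scale_one S.scale_scale nonzero_eq_divide_eq)
  \<comment> \<open>\<open>w\<close> is the direction of the component of \<open>x z\<close> in the span of \<open>z\<^sub>1\<close> and \<open>z\<^sub>2\<close>, once a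
    multiple of \<open>x\<close> has removed the component in \<open>E\<close>.\<close>
  define w :: "('a, 'e) ssf" where "w = (0, \<alpha> - 1, \<alpha> + 1)"
  define k where "k = \<alpha> * (2 * \<alpha> - 1) / 2"
  have "k \<noteq> 0"
    using \<alpha>_neq two_neq_0 by (auto simp: k_def field_simps)
  have "k \<odot> w = axis_of e \<star> z - (\<alpha> - 1 - \<alpha>\<^sup>2) \<odot> axis_of e"
  proof -
    have "(\<alpha> * (\<alpha> * (\<alpha> - 2)) + (1 - \<alpha>) * ((\<alpha> - 1) * (\<alpha> + 1))) * (1 / 2) = (\<alpha> - 1 - \<alpha>\<^sup>2) * (1 / 2)"
      by (simp add: algebra_simps power2_eq_square)
    then show ?thesis
      using two_neq_0
      by (simp add: w_def k_def axis_of_coords ssf_coords form_simps)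
        (simp add: field_simps power2_eq_square)
  qed
  also have "\<dots> \<in> U"
    by (intro closure e z)
  finally have "(1 / k) \<odot> (k \<odot> w) \<in> U"
    by (rule closure)
  then have w: "w \<in> U"
    using \<open>k \<noteq> 0\<close> by simp
  have "ssf_z1 = (\<alpha> - 1) \<odot> w - z"
    by (simp add: w_def ssf_coords algebra_simps)
  also have "\<dots> \<in> U"
    by (intro closure w z)
  finally have z1: "ssf_z1 \<in> U" .
  have "\<alpha> + 1 \<noteq> 0"
    using \<alpha>_neq(3) by (simp add: eq_neg_iff_add_eq_0)
  then have "ssf_z2 = (1 / (\<alpha> + 1)) \<odot> (w - (\<alpha> - 1) \<odot> ssf_z1)"
    by (simp add: w_def ssf_coords)
  also have "\<dots> \<in> U"
    by (intro closure w z1)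
  finally have z2: "ssf_z2 \<in> U" .
  have emb: "ssf_emb u \<in> U" if "axis_of u \<in> U" for u
  proof -
    have "ssf_emb u = 2 \<odot> axis_of u - \<alpha> \<odot> ssf_z1 - (\<alpha> + 1) \<odot> ssf_z2"
      using two_neq_0 by (simp add: axis_of_coords ssf_coords)
    also have "\<dots> \<in> U"
      by (intro closure that z1 z2)
    finally show ?thesis .
  qed
  have "E.subspace {u. ssf_emb u \<in> U}"
  proof (rule E.subspaceI)
    show "0 \<in> {u. ssf_emb u \<in> U}"
      using S.subspace_0[OF subspace] by (simp add: ssf_emb_def zero_prod_def)
    show "u + v \<in> {u. ssf_emb u \<in> U}"
      if "u \<in> {u. ssf_emb u \<in> U}" "v \<in> {u. ssf_emb u \<in> U}" for u v
      using closure(1)[of "ssf_emb u" "ssf_emb v"] that by (simp add: ssf_emb_def)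
    show "smul c u \<in> {u. ssf_emb u \<in> U}" if "u \<in> {u. ssf_emb u \<in> U}" for c u
      using closure(3)[of "ssf_emb u" c] that by (simp add: ssf_coords)
  qed
  then have "E.span {e, f} \<subseteq> {u. ssf_emb u \<in> U}"
    using emb e f by (intro E.span_minimal) auto
  then have emb_UNIV: "ssf_emb u \<in> U" for u
    using span_UNIV by auto
  have "v \<in> U" for v
  proof (cases v)
    case (fields u r t)
    then have "v = ssf_emb u + r \<odot> ssf_z1 + t \<odot> ssf_z2"
      by (simp add: ssf_coords)
    also have "\<dots> \<in> U"
      by (intro closure emb_UNIV z1 z2)
    finally show ?thesis .
  qed
  then show ?thesis
    by auto
qed

text \<open>The hull is the intersection of all subalgebras that contain the two elements, and each of them
  is the whole algebra.\<close>

lemma generates: "generates_algebra scale product {axis_of e, axis_of f}"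
  using subalgebra_eq_UNIV by (auto simp: generates_algebra_def hull_def)

section \<open>The isomorphism with Yabe's algebra\<close>

text \<open>The parameter of Yabe's algebra that corresponds to \<open>\<mu>\<close>.\<close>

definition \<delta> :: 'a
  where "\<delta> = - 2 * \<mu> - 1"

text \<open>The scalar by which \<open>q\<close> multiplies every basis vector of Yabe's algebra.\<close>

definition \<kappa> :: 'a
  where "\<kappa> = - (\<alpha> * (\<alpha> + 1) * (\<delta> + 3) / 8)"

lemma \<kappa>_eq: "\<kappa> = - (\<alpha> * (\<alpha> + 1) * (1 - \<mu>) / 4)"
  using numerals_neq_0 by (simp add: \<kappa>_def \<delta>_def field_simps)

lemma \<kappa>_neq_0: "\<kappa> \<noteq> 0"
  using \<alpha>_neq form_ef four_neq_0 by (simp add: \<kappa>_eq eq_neg_iff_add_eq_0)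

text \<open>The images of the basis vectors of Yabe's algebra. The vector \<open>2 \<mu> e - f\<close> is the image of \<open>f\<close>
  under the reflection that fixes \<open>e\<close>, which matches the symmetry of Yabe's algebra that fixes
  \<open>a\<^sub>0\<close> and exchanges \<open>a\<^sub>1\<close> and \<open>a\<^sub>-\<^sub>1\<close>.\<close>

fun yabe_image :: "yabe_index \<Rightarrow> ('a, 'e) ssf"
  where
    "yabe_image Am = axis_of (smul (2 * \<mu>) e - f)"
  | "yabe_image A0 = axis_of e"
  | "yabe_image A1 = axis_of f"
  | "yabe_image Q = \<kappa> \<odot> (ssf_z1 + ssf_z2)"

text \<open>The linear extension of the assignment on basis vectors.\<close>

definition yabe_map :: "'a ^ yabe_index \<Rightarrow> ('a, 'e) ssf"
  where "yabe_map v = (\<Sum>i\<in>UNIV. (v $ i) \<odot> yabe_image i)"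

lemma yabe_map_linear: "Vector_Spaces.linear (*s) scale yabe_map"
proof
  show "yabe_map (v + w) = yabe_map v + yabe_map w" for v w
    by (simp add: yabe_map_def S.scale_left_distrib sum.distrib)
  show "yabe_map (c *s v) = c \<odot> yabe_map v" for c v
    by (simp add: yabe_map_def S.scale_sum_right)
qed

sublocale yabe_map: Vector_Spaces.linear "(*s)" scale yabe_map
  by (rule yabe_map_linear)

lemma yabe_map_basis: "yabe_map (yabe_basis i) = yabe_image i"
proof -
  have "(yabe_basis i $ j) \<odot> yabe_image j = (if j = i then yabe_image j else 0)" for j
    by (simp add: axis_def)
  then show ?thesis
    by (simp add: yabe_map_def)
qed

lemmas yabe_map_simps = yabe_map.add yabe_map.scale yabe_map_basis

text \<open>In the image of \<open>a\<^sub>1 + a\<^sub>-\<^sub>1 + (\<delta> + 1) a\<^sub>0\<close> the components in \<open>E\<close> cancel, as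
  \<open>f + (2 \<mu> e - f) = - (\<delta> + 1) e\<close>; what remains lies in the span of \<open>z\<^sub>1\<close> and \<open>z\<^sub>2\<close>.\<close>

lemma yabe_map_s: "yabe_map (yabe_s \<alpha> \<delta>) = ((1 - \<mu>) / 4) \<odot> z"
proof -
  have "axis_of f + axis_of (smul (2 * \<mu>) e - f) + (\<delta> + 1) \<odot> axis_of e =
      (1 - \<mu>) \<odot> (0, \<alpha>, \<alpha> + 1)"
    using two_neq_0
    by (simp add: axis_of_coords ssf_coords \<delta>_def E.scale_right_diff_distrib)
      (simp add: field_simps)
  then have "yabe_map (yabe_s \<alpha> \<delta>) =
      ((2 * \<alpha> - 1) / 4) \<odot> ((1 - \<mu>) \<odot> (0, \<alpha>, \<alpha> + 1)) + \<kappa> \<odot> (ssf_z1 + ssf_z2)"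
    by (simp only: yabe_s_def yabe_map_simps yabe_image.simps)
  also have "\<dots> = ((1 - \<mu>) / 4) \<odot> z"
  proof -
    define h :: 'a where "h = 1 / 4"
    have quarter: "c / 4 = c * h" for c
      by (simp add: h_def)
    show ?thesis
      unfolding \<kappa>_eq quarter by (simp add: ssf_coords algebra_simps)
  qed
  finally show ?thesis .
qed

lemma form_reflection:
  "b e (smul (2 * \<mu>) e - f) = \<mu>"
  "b f (smul (2 * \<mu>) e - f) = 2 * \<mu>\<^sup>2 - 1"
  "b (smul (2 * \<mu>) e - f) (smul (2 * \<mu>) e - f) = 1"
proof -
  have diff: "b (u - v) w = b u w - b v w" "b w (u - v) = b w u - b w v" for u v w
    using form_simps(1)[of "u - v" v w] form_simps(2)[of w "u - v" v] by simp_all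
  have fe: "b f e = \<mu>"
    by (rule form_commute)
  show "b e (smul (2 * \<mu>) e - f) = \<mu>"
    by (simp add: diff form_simps form_e)
  show "b f (smul (2 * \<mu>) e - f) = 2 * \<mu>\<^sup>2 - 1"
    by (simp add: diff form_simps form_f fe power2_eq_square)
  show "b (smul (2 * \<mu>) e - f) (smul (2 * \<mu>) e - f) = 1"
    by (simp add: diff form_simps form_e form_f fe power2_eq_square algebra_simps)
qed

lemma yabe_map_table: "yabe_map (yabe_table \<alpha> \<delta> i j) = yabe_image i \<star> yabe_image j"
proof -
  have fixed: "yabe_map (yabe_table \<alpha> \<delta> Q j) = yabe_image Q \<star> yabe_image j" for j
    by (simp only: yabe_table.simps yabe_map_simps yabe_image.simps one_mult \<kappa>_def)
  have e_f: "yabe_map (yabe_table \<alpha> \<delta> A0 A1) = yabe_image A0 \<star> yabe_image A1"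
    by (simp add: yabe_map_simps yabe_map_s axis_of_mult)
  have e_m: "yabe_map (yabe_table \<alpha> \<delta> A0 Am) = yabe_image A0 \<star> yabe_image Am"
    by (simp add: yabe_map_simps yabe_map_s axis_of_mult form_reflection)
  \<comment> \<open>The factor \<open>1 - \<delta> = 2 (1 + \<mu>)\<close> turns \<open>1 - \<mu>\<close> into \<open>1 - b f (2 \<mu> e - f) = 2 (1 - \<mu>\<^sup>2)\<close>.\<close>
  have "(1 - \<delta>) * (1 - \<mu>) = 1 - (2 * \<mu>\<^sup>2 - 1)"
    by (simp add: \<delta>_def power2_eq_square algebra_simps)
  then have f_m: "yabe_map (yabe_table \<alpha> \<delta> A1 Am) = yabe_image A1 \<star> yabe_image Am"
    by (simp only: yabe_table.simps yabe_map_simps yabe_map_s yabe_image.simps axis_of_mult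
        form_reflection S.scale_scale times_divide_eq_right)
  have diag: "yabe_map (yabe_table \<alpha> \<delta> i i) = yabe_image i \<star> yabe_image i" for i
    using fixed[of Q]
    by (cases i) (simp_all add: yabe_map_basis axis_of_idempotent form_e form_f form_reflection)
  have table: "yabe_map (yabe_table \<alpha> \<delta> j i) = yabe_image j \<star> yabe_image i"
    if "yabe_map (yabe_table \<alpha> \<delta> i j) = yabe_image i \<star> yabe_image j" for i j
    using that yabe_table_commute S.mult_commute by metis
  show ?thesis
    by (cases i; cases j)
      (simp_all only: fixed e_f e_m f_m diag table[OF fixed] table[OF e_f] table[OF e_m] table[OF f_m])
qed

lemma yabe_map_mult: "yabe_map (yabe_mult \<alpha> \<delta> v w) = yabe_map v \<star> yabe_map w"
proof -
  have "yabe_map (yabe_mult \<alpha> \<delta> v w) =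
      (\<Sum>i\<in>UNIV. \<Sum>j\<in>UNIV. (v $ i * w $ j) \<odot> (yabe_image i \<star> yabe_image j))"
    by (simp add: yabe_mult_def yabe_map.sum yabe_map.scale yabe_map_table)
  also have "\<dots> = yabe_map v \<star> yabe_map w"
    by (simp add: yabe_map_def S.mult_sum_scale)
  finally show ?thesis .
qed

lemma e_f_independent:
  assumes "smul p e + smul q f = 0"
  shows "p = 0" and "q = 0"
  using E.scale_pair_eq_zero_imp[of e f p q] E.scale_pair_eq_zero_imp[of f e q p]
    assms span_UNIV dim_2 by (simp_all add: insert_commute add.commute)

lemma yabe_map_inj: "inj yabe_map"
proof -
  have "v = 0" if zero: "yabe_map v = 0" for v
  proof -
    define m k l q where "m = v $ Am" and "k = v $ A0" and "l = v $ A1" and "q = v $ Q"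
    have "yabe_map v = m \<odot> yabe_image Am + k \<odot> yabe_image A0 + l \<odot> yabe_image A1 + q \<odot> yabe_image Q"
      by (simp add: yabe_map_def sum_yabe_index m_def k_def l_def q_def)
    also have "\<dots> = (smul ((2 * \<mu> * m + k) / 2) e + smul ((l - m) / 2) f,
        \<alpha> * (m + k + l) / 2 + \<kappa> * q, (\<alpha> + 1) * (m + k + l) / 2 + \<kappa> * q)"
      using two_neq_0
      by (simp add: axis_of_coords ssf_coords E.scale_right_diff_distrib)
        (simp add: add_divide_distrib diff_divide_distrib E.scale_left_distrib
          E.scale_left_diff_distrib algebra_simps)
    finally have E0: "smul ((2 * \<mu> * m + k) / 2) e + smul ((l - m) / 2) f = 0"
      and z1: "\<alpha> * (m + k + l) / 2 + \<kappa> * q = 0"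
      and z2: "(\<alpha> + 1) * (m + k + l) / 2 + \<kappa> * q = 0"
      using zero by (simp_all add: zero_prod_def)
    have k: "k = - (2 * \<mu> * m)" and l: "l = m"
      using e_f_independent[OF E0] two_neq_0 by (simp_all add: eq_neg_iff_add_eq_0 add.commute)
    \<comment> \<open>The coordinates at \<open>z\<^sub>1\<close> and \<open>z\<^sub>2\<close> differ by \<open>(m + k + l) / 2\<close>.\<close>
    have "(m + k + l) / 2 =
        ((\<alpha> + 1) * (m + k + l) / 2 + \<kappa> * q) - (\<alpha> * (m + k + l) / 2 + \<kappa> * q)"
      by (simp add: algebra_simps add_divide_distrib)
    then have "(m + k + l) / 2 = 0"
      by (simp only: z1 z2 diff_self)
    then have sum: "m + k + l = 0"
      using two_neq_0 by simp
    then have q: "q = 0"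
      using z1 \<kappa>_neq_0 by simp
    have "2 * (1 - \<mu>) * m = 0"
      using sum by (simp add: k l algebra_simps)
    then have m: "m = 0"
      using two_neq_0 form_ef by simp
    have "v $ i = 0" for i
      using m k l q by (cases i) (simp_all add: m_def k_def l_def q_def)
    then show ?thesis
      by (simp add: vec_eq_iff)
  qed
  then show ?thesis
    by (simp add: yabe_map.inj_iff_eq_0)
qed

lemma yabe_map_surj: "surj yabe_map"
proof (rule subalgebra_eq_UNIV)
  have "yabe_map v \<star> yabe_map w \<in> range yabe_map" for v w
    by (simp flip: yabe_map_mult)
  then show "subalgebra scale product (range yabe_map)"
    using yabe_map.subspace_image[OF vec.subspace_UNIV] by (auto simp: subalgebra_def)
  show "axis_of e \<in> range yabe_map"
    using yabe_map_basis[of A0] by (metis rangeI yabe_image.simps(2))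
  show "axis_of f \<in> range yabe_map"
    using yabe_map_basis[of A1] by (metis rangeI yabe_image.simps(3))
qed

lemma isomorphic_yabe: "algebra_isomorphic scale product (*s) (yabe_mult \<alpha> \<delta>)"
proof (rule algebra_isomorphic_sym)
  show "algebra_isomorphic (*s) (yabe_mult \<alpha> \<delta>) scale product"
    unfolding algebra_isomorphic_def bij_def
    using yabe_map_linear yabe_map_inj yabe_map_surj yabe_map_mult by blast
qed

end

theorem theorem4:
  fixes smul :: "'a::field \<Rightarrow> 'e::ab_group_add \<Rightarrow> 'e"
    and b :: "'e \<Rightarrow> 'e \<Rightarrow> 'a"
    and \<alpha> \<mu> \<delta> :: 'a
    and e f :: 'e
    and x y :: "('a, 'e) ssf"
  assumes "CHAR('a) \<noteq> 2"
    and "\<alpha> \<notin> {0, 1, 1 / 2}"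
    and "vector_space smul"
    and "vector_space.dim smul (UNIV :: 'e set) = 2"
    and "symmetric_bilinear_form smul b"
    and "module.span smul {e, f} = UNIV"
    and "b e e = 1" and "b f f = 1"
    and "\<mu> = b e f"
    and "x = ssf_scale smul (1 / 2)
               (ssf_emb e + ssf_scale smul \<alpha> ssf_z1 + ssf_scale smul (\<alpha> + 1) ssf_z2)"
    and "y = ssf_scale smul (1 / 2)
               (ssf_emb f + ssf_scale smul \<alpha> ssf_z1 + ssf_scale smul (\<alpha> + 1) ssf_z2)"
    and "\<alpha> \<noteq> - 1" and "\<mu> \<noteq> 1"
    and "\<delta> = - 2 * \<mu> - 1"
  shows "generates_algebra (ssf_scale smul) (ssf_mult smul b \<alpha>) {x, y} \<and>
         algebra_isomorphic (ssf_scale smul) (ssf_mult smul b \<alpha>) (*s) (yabe_mult \<alpha> \<delta>)"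
proof -
  have "\<not> CHAR('a) dvd 2"
  proof
    assume "CHAR('a) dvd 2"
    then have "CHAR('a) \<le> 2" and "CHAR('a) \<noteq> 0"
      using dvd_imp_le[of "CHAR('a)" 2] by (simp, metis dvd_0_left_iff zero_neq_numeral)
    then show False
      using assms(1) CHAR_not_1[where 'a = 'a] by linarith
  qed
  then have "(2 :: 'a) \<noteq> 0"
    by (metis of_nat_eq_0_iff_char_dvd of_nat_numeral)
  interpret spanned_split_spin_factor smul b \<alpha> e f
    using assms(2-9,12,13) \<open>(2 :: 'a) \<noteq> 0\<close>
    by (intro spanned_split_spin_factor.intro split_spin_factor.intro
        spanned_split_spin_factor_axioms.intro) simp_all
  have "\<delta> = local.\<delta>"
    using assms(9,14) \<delta>_def by simp
  moreover have "x = axis_of e" and "y = axis_of f"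
    using assms(10,11) by (simp_all add: axis_of_def)
  ultimately show ?thesis
    using generates isomorphic_yabe by simp
qed

end
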